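(* Let $k\geq1$ and let $G$ be a graph. Then $(-1)^{|G|}P_{chr}(G)(-k)$ is the number of pairs $(f,O)$ where: \begin{itemize} \item $f$ is a map from $V(G)$ to $\{1,\ldots,k\}$. \item $O$ is an acyclic orientation of $G$. \item If there is an oriented edge from $x$ to $y$ in $G$ for the orientation $O$, then $f(x)\leq f(y)$. \end{itemize}
   Context: A graph is a pair $G=(V(G),E(G))$ with $V(G)$ a finite set and $E(G)$ a set of $2$-element subsets of $V(G)$; $|G|=\sharp V(G)$. $P_{chr}(G)\in\mathbb{Q}[X]$ is the chromatic polynomial: for $k\geq1$, $P_{chr}(G)(k)$ is the number of maps $f:V(G)\to\{1,\ldots,k\}$ with $f(x)\neq f(y)$ for every edge $\{x,y\}$. An acyclic orientation of a graph is a choice of direction for each edge producing no oriented cycle (a graph without edges has exactly one). *)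

theory Defs
  imports "HOL-Library.FuncSet" "HOL-Computational_Algebra.Polynomial"
begin

locale fin_graph =
  fixes V :: "'a set" and E :: "'a set set"
  assumes finite_vertices: "finite V"
    and edges_two_subsets: "e \<in> E \<Longrightarrow> e \<subseteq> V \<and> card e = 2"

text \<open>Maps on the vertex set are extensional functions, so that they can be counted.\<close>

definition proper_colourings :: "'a set \<Rightarrow> 'a set set \<Rightarrow> nat \<Rightarrow> ('a \<Rightarrow> nat) set" where
  "proper_colourings V E k =
     {f \<in> V \<rightarrow>\<^sub>E {1..k}. \<forall>x y. {x, y} \<in> E \<longrightarrow> f x \<noteq> f y}"

definition chromatic_poly :: "'a set \<Rightarrow> 'a set set \<Rightarrow> rat poly" where
  "chromatic_poly V E =
     (THE p. \<forall>k\<ge>1. poly p (of_nat k) = of_nat (card (proper_colourings V E k)))"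

text \<open>An orientation is the set of its directed edges: \<open>(x, y) \<in> D\<close> means that the edge
  \<open>{x, y}\<close> is directed from \<open>x\<close> to \<open>y\<close>.\<close>

definition orientation :: "'a set set \<Rightarrow> ('a \<times> 'a) set \<Rightarrow> bool" where
  "orientation E D \<longleftrightarrow>
     (\<forall>x y. (x, y) \<in> D \<longrightarrow> {x, y} \<in> E) \<and>
     (\<forall>x y. {x, y} \<in> E \<longrightarrow> ((x, y) \<in> D) \<noteq> ((y, x) \<in> D))"

definition acyclic_orientation :: "'a set set \<Rightarrow> ('a \<times> 'a) set \<Rightarrow> bool" where
  "acyclic_orientation E D \<longleftrightarrow> orientation E D \<and> acyclic D"

text \<open>The polynomial described by \<open>chromatic_poly\<close> exists and is unique; existence is proved by
  deletion and contraction, for edge lists that may contain loops.\<close>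

lemma colouring_count_poly:
  assumes "finite V" "set es \<subseteq> V \<times> V"
  shows "\<exists>p :: rat poly. \<forall>k. poly p (of_nat k) =
           of_nat (card {f \<in> V \<rightarrow>\<^sub>E {1..k::nat}. \<forall>(x, y) \<in> set es. f x \<noteq> f y})"
  using assms
proof (induction "length es" arbitrary: V es)
  case 0
  then show ?case
    by (intro exI[of _ "monom 1 (card V)"]) (simp add: poly_monom card_PiE)
next
  case (Suc n)
  then obtain x y es' where es: "es = (x, y) # es'" and len: "length es' = n"
    by (metis length_Suc_conv surj_pair)
  show ?case
  proof (cases "x = y")
    case True
    then show ?thesis
      by (intro exI[of _ 0]) (simp add: es)
  next
    case False
    have xy: "x \<in> V" "y \<in> V" and es': "set es' \<subseteq> V \<times> V"
      using Suc.prems es by auto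
    define r where "r v = (if v = y then x else v)" for v
    define es'' where "es'' = map (map_prod r r) es'"
    define A where "A k = {f \<in> V \<rightarrow>\<^sub>E {1..k::nat}. \<forall>(u, v) \<in> set es'. f u \<noteq> f v}" for k
    define B where "B k = {f \<in> A k. f x = f y}" for k
    define C where "C k = {f \<in> (V - {y}) \<rightarrow>\<^sub>E {1..k::nat}. \<forall>(u, v) \<in> set es''. f u \<noteq> f v}" for k
    obtain p :: "rat poly" where p: "\<And>k. poly p (of_nat k) = of_nat (card (A k))"
      using Suc.hyps(1)[OF len[symmetric] Suc.prems(1) es'] unfolding A_def by blast
    have rV: "r v \<in> V - {y}" if "v \<in> V" for v
      using that xy False by (simp add: r_def)
    have ball_es'': "(\<forall>(u, v) \<in> set es''. P u v) \<longleftrightarrow> (\<forall>(u, v) \<in> set es'. P (r u) (r v))" for P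
      by (simp add: es''_def case_prod_unfold)
    have "r u \<in> V - {y} \<and> r v \<in> V - {y}" if "(u, v) \<in> set es'" for u v
    proof -
      have "u \<in> V" "v \<in> V"
        using that es' by auto
      then show ?thesis
        by (intro conjI rV)
    qed
    then have "\<forall>(u, v) \<in> set es''. u \<in> V - {y} \<and> v \<in> V - {y}"
      unfolding ball_es'' by (intro ballI case_prodI2) simp
    then have "set es'' \<subseteq> (V - {y}) \<times> (V - {y})"
      by auto
    moreover have "n = length es''" "finite (V - {y})"
      using len Suc.prems(1) by (simp_all add: es''_def)
    ultimately obtain q :: "rat poly" where q: "\<And>k. poly q (of_nat k) = of_nat (card (C k))"
      using Suc.hyps(1)[of es'' "V - {y}"] unfolding C_def by blast
    have bij: "bij_betw (\<lambda>f. restrict f (V - {y})) (B k) (C k)" for k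
    proof (rule bij_betwI[where g = "\<lambda>g. g(y := g x)"])
      show "(\<lambda>f. restrict f (V - {y})) \<in> B k \<rightarrow> C k"
      proof
        fix f assume f: "f \<in> B k"
        then have val: "restrict f (V - {y}) (r v) = f v" if "v \<in> V" for v
          using that xy False by (auto simp: r_def B_def)
        have "restrict f (V - {y}) (r u) \<noteq> restrict f (V - {y}) (r v)" if "(u, v) \<in> set es'" for u v
        proof -
          have "u \<in> V" "v \<in> V" "f u \<noteq> f v"
            using f es' that by (auto simp: B_def A_def)
          then show ?thesis
            by (simp only: val not_False_eq_True)
        qed
        then have "\<forall>(u, v) \<in> set es''. restrict f (V - {y}) u \<noteq> restrict f (V - {y}) v"
          unfolding ball_es'' by blast
        moreover have "restrict f (V - {y}) \<in> (V - {y}) \<rightarrow>\<^sub>E {1..k}"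
          using f unfolding B_def A_def by auto
        ultimately show "restrict f (V - {y}) \<in> C k"
          unfolding C_def by blast
      qed
      show "(\<lambda>g. g(y := g x)) \<in> C k \<rightarrow> B k"
      proof
        fix g assume g: "g \<in> C k"
        have val: "(g(y := g x)) v = g (r v)" for v
          by (simp add: r_def)
        have ne: "g (r u) \<noteq> g (r v)" if "(u, v) \<in> set es'" for u v
          using g that unfolding C_def ball_es'' by blast
        have "g(y := g x) \<in> V \<rightarrow>\<^sub>E {1..k}"
          using g xy False by (auto simp: C_def PiE_iff extensional_def)
        moreover have "\<forall>(u, v) \<in> set es'. (g(y := g x)) u \<noteq> (g(y := g x)) v"
          unfolding val using ne by blast
        ultimately show "g(y := g x) \<in> B k"
          using False by (simp add: B_def A_def)
      qed
      show "(restrict f (V - {y}))(y := restrict f (V - {y}) x) = f" if "f \<in> B k" for f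
        using that xy False by (auto simp: B_def A_def PiE_iff extensional_def)
      show "restrict (g(y := g x)) (V - {y}) = g" if "g \<in> C k" for g
        using that by (auto simp: C_def PiE_iff extensional_def)
    qed
    have fin: "finite (A k)" for k
      unfolding A_def using Suc.prems(1) by (simp add: finite_PiE)
    have "card (B k) \<le> card (A k)" for k
      using fin by (auto simp: B_def intro: card_mono)
    moreover have "{f \<in> V \<rightarrow>\<^sub>E {1..k}. \<forall>(u, v) \<in> set es. f u \<noteq> f v} = A k - B k" for k
      by (auto simp: es A_def B_def)
    moreover have "card (A k - B k) = card (A k) - card (B k)" for k
      using fin by (intro card_Diff_subset) (auto simp: B_def intro: finite_subset[OF _ fin])
    ultimately show ?thesis
      using p q bij_betw_same_card[OF bij]
      by (intro exI[of _ "p - q"]) simp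
  qed
qed

lemma poly_eq_if_eq_on_positive_nats:
  fixes p q :: "rat poly"
  assumes "\<And>k::nat. k \<ge> 1 \<Longrightarrow> poly p (of_nat k) = poly q (of_nat k)"
  shows "p = q"
proof (rule ccontr)
  assume "p \<noteq> q"
  then have "finite {x. poly (p - q) x = 0}"
    by (intro poly_roots_finite) simp
  moreover have "of_nat ` {1::nat..} \<subseteq> {x. poly (p - q) x = 0}"
    using assms by auto
  moreover have "infinite ((of_nat :: nat \<Rightarrow> rat) ` {1..})"
    by (simp add: finite_image_iff infinite_Ici inj_on_def)
  ultimately show False
    using finite_subset by blast
qed

lemma (in fin_graph) poly_chromatic_poly:
  assumes "k \<ge> 1"
  shows "poly (chromatic_poly V E) (of_nat k) = of_nat (card (proper_colourings V E k))"
proof -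
  have sub: "{(x, y). {x, y} \<in> E} \<subseteq> V \<times> V"
    using edges_two_subsets by blast
  then have "finite {(x, y). {x, y} \<in> E}"
    using finite_vertices finite_subset by blast
  then obtain es where es: "set es = {(x, y). {x, y} \<in> E}"
    using finite_list by blast
  obtain p :: "rat poly" where
    "\<forall>k. poly p (of_nat k) = of_nat (card (proper_colourings V E k))"
    using colouring_count_poly[of V es] finite_vertices sub
    unfolding es proper_colourings_def by auto
  then have "\<exists>!p :: rat poly.
      \<forall>k\<ge>1. poly p (of_nat k) = of_nat (card (proper_colourings V E k))"
    by (intro ex1I[of _ p]) (auto intro: poly_eq_if_eq_on_positive_nats)
  from theI'[OF this] show ?thesis
    using assms unfolding chromatic_poly_def by blast
qed

end

theory Submission
  imports Defs
begin

text \<open>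
  This is Stanley's reciprocity theorem. Write \<open>p S\<close> for the chromatic polynomial of the subgraph
  induced on \<open>S\<close> and \<open>N S k\<close> for the number of pairs of a map and an acyclic orientation of this
  subgraph that are compatible with colours \<open>1, \<dots>, k\<close>. The proof shows that \<open>N S k\<close> and
  \<open>(- 1) ^ card S * poly (p S) (- k)\<close> satisfy the same recurrence, in which \<open>T\<close> ranges over
  the independent subsets of \<open>V\<close>.

  On the chromatic side, the vertices of colour \<open>k + 1\<close> in a proper colouring with \<open>k + 1\<close> colours
  form an independent set \<open>T\<close>, and what remains is any proper colouring of \<open>V - T\<close> with \<open>k\<close> colours.
  So \<open>p V (x + 1) = (\<Sum>T. p (V - T) x)\<close> for positive integers \<open>x\<close>, and therefore for all \<open>x\<close>
  (\<open>chromatic_poly_shift\<close>). At \<open>x = - (k + 1)\<close> this expresses \<open>p V (- k)\<close> by the values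
  \<open>p (V - T) (- (k + 1))\<close>.

  On the side of orientations, the matching identity is
  \<open>N V k = (\<Sum>T. (- 1) ^ card T * N (V - T) (k + 1))\<close> (\<open>card_compatible_pairs_shift\<close>).
  A compatible pair on \<open>V - T\<close> extends in exactly one way to a compatible pair on \<open>V\<close> in which all
  vertices of \<open>T\<close> are sinks of the top colour \<open>k + 1\<close>. Hence the right-hand side counts each pair
  on \<open>V\<close> with weight \<open>\<Sum>(- 1) ^ card T\<close>, where \<open>T\<close> runs through the subsets of its set of
  top-coloured sinks. This weight vanishes unless that set is empty. Finally, since colours do not
  decrease along directed edges, a nonempty top colour class is closed under successors and
  contains a sink by acyclicity; so the pairs that survive are those that avoid the top colour,
  and there are \<open>N V k\<close> of them.

  In both recurrences the term for \<open>T = {}\<close> concerns \<open>V\<close> itself with parameter \<open>k + 1\<close>, and all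
  other terms concern smaller vertex sets. Both sides agree at \<open>k = 0\<close>, so induction on
  \<open>card V\<close> and then on \<open>k\<close> gives the theorem.
\<close>

section \<open>Induced subgraphs and independent sets\<close>

definition induced_edges :: "'a set set \<Rightarrow> 'a set \<Rightarrow> 'a set set" where
  "induced_edges E S = {e \<in> E. e \<subseteq> S}"

definition independent_sets :: "'a set \<Rightarrow> 'a set set \<Rightarrow> 'a set set" where
  "independent_sets V E = {T. T \<subseteq> V \<and> (\<forall>x\<in>T. \<forall>y\<in>T. {x, y} \<notin> E)}"

lemma (in fin_graph) fin_graph_induced: "fin_graph S (induced_edges E S)" if "S \<subseteq> V"
  using that finite_subset[OF that finite_vertices] edges_two_subsets
  by (auto simp: fin_graph_def induced_edges_def)

lemma (in fin_graph) induced_edges_all: "induced_edges E V = E"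
  using edges_two_subsets by (auto simp: induced_edges_def)

lemma (in fin_graph) edge_endpoints:
  assumes "{x, y} \<in> E" shows "x \<in> V" "y \<in> V" "x \<noteq> y"
  using edges_two_subsets[OF assms] by auto

lemma (in fin_graph) finite_independent_sets: "finite (independent_sets V E)"
  by (rule finite_subset[of _ "Pow V"]) (auto simp: independent_sets_def finite_vertices)

lemma (in fin_graph) empty_in_independent_sets: "{} \<in> independent_sets V E"
  by (simp add: independent_sets_def)

section \<open>The top colour class of a proper colouring\<close>

text \<open>A proper colouring is determined by the independent set of vertices of the top colour and its
  restriction to the remaining vertices, where it uses the other \<open>k\<close> colours.\<close>

lemma (in fin_graph) card_proper_colourings_Suc:
  "card (proper_colourings V E (Suc k)) =
     (\<Sum>T\<in>independent_sets V E. card (proper_colourings (V - T) (induced_edges E (V - T)) k))"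
proof -
  define top where "top f = {v \<in> V. f v = Suc k}" for f :: "'a \<Rightarrow> nat"
  let ?A = "proper_colourings V E (Suc k)"
  let ?B = "\<lambda>T. proper_colourings (V - T) (induced_edges E (V - T)) k"
  have fin: "finite ?A"
    unfolding proper_colourings_def using finite_vertices by (simp add: finite_PiE)
  have top: "top ` ?A \<subseteq> independent_sets V E"
    by (auto simp: top_def proper_colourings_def independent_sets_def) metis
  have fibre: "card {f \<in> ?A. top f = T} = card (?B T)" if T: "T \<in> independent_sets V E" for T
  proof (rule bij_betw_same_card, rule bij_betwI)
    have TV: "T \<subseteq> V" and indep: "\<And>x y. x \<in> T \<Longrightarrow> y \<in> T \<Longrightarrow> {x, y} \<notin> E"
      using T by (auto simp: independent_sets_def)
    show "(\<lambda>f. restrict f (V - T)) \<in> {f \<in> ?A. top f = T} \<rightarrow> ?B T"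
    proof
      fix f assume "f \<in> {f \<in> ?A. top f = T}"
      then have f: "f \<in> V \<rightarrow>\<^sub>E {1..Suc k}" "top f = T"
        and ne: "\<And>x y. {x, y} \<in> E \<Longrightarrow> f x \<noteq> f y"
        by (auto simp: proper_colourings_def)
      have "f v \<in> {1..k}" if "v \<in> V - T" for v
        using that f PiE_mem[OF f(1), of v] by (auto simp: top_def)
      then show "restrict f (V - T) \<in> ?B T"
        using ne by (auto simp: proper_colourings_def induced_edges_def)
    qed
    show "(\<lambda>g v. if v \<in> T then Suc k else g v) \<in> ?B T \<rightarrow> {f \<in> ?A. top f = T}"
    proof
      fix g assume "g \<in> ?B T"
      then have g: "g \<in> (V - T) \<rightarrow>\<^sub>E {1..k}"
        and ne: "\<And>x y. {x, y} \<in> induced_edges E (V - T) \<Longrightarrow> g x \<noteq> g y"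
        by (auto simp: proper_colourings_def)
      let ?f = "\<lambda>v. if v \<in> T then Suc k else g v"
      have gk: "g v \<in> {1..k}" if "v \<in> V" "v \<notin> T" for v
        using PiE_mem[OF g, of v] that by simp
      then have gk_ne: "g v \<noteq> Suc k" if "v \<in> V" "v \<notin> T" for v
        using that by fastforce
      have "?f \<in> V \<rightarrow>\<^sub>E {1..Suc k}"
        using gk TV g by (fastforce simp: PiE_iff extensional_def)
      moreover have "?f x \<noteq> ?f y" if e: "{x, y} \<in> E" for x y
        using indep[of x y] ne[of x y] edge_endpoints[OF e] e gk[of x] gk[of y]
        by (auto simp: induced_edges_def)
      moreover have "top ?f = T"
        using TV gk_ne by (auto simp: top_def)
      ultimately show "?f \<in> {f \<in> ?A. top f = T}"
        by (simp add: proper_colourings_def)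
    qed
    show "(\<lambda>v. if v \<in> T then Suc k else restrict f (V - T) v) = f"
      if "f \<in> {f \<in> ?A. top f = T}" for f
      using that by (fastforce simp: top_def proper_colourings_def PiE_iff extensional_def)
    show "restrict (\<lambda>v. if v \<in> T then Suc k else g v) (V - T) = g" if "g \<in> ?B T" for g
      using that by (fastforce simp: proper_colourings_def PiE_iff extensional_def)
  qed
  have "card ?A = (\<Sum>T\<in>independent_sets V E. card {f \<in> ?A. top f = T})"
    using sum.group[OF fin finite_independent_sets top, of "\<lambda>_. 1::nat"] by simp
  also have "\<dots> = (\<Sum>T\<in>independent_sets V E. card (?B T))"
    using fibre by simp
  finally show ?thesis .
qed

text \<open>Both sides are polynomials in \<open>x\<close> that agree at the positive integers by the previous count,
  so the recurrence may also be used at negative arguments.\<close>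

lemma (in fin_graph) chromatic_poly_shift:
  "poly (chromatic_poly V E) (x + 1) =
     (\<Sum>T\<in>independent_sets V E. poly (chromatic_poly (V - T) (induced_edges E (V - T))) x)"
proof -
  have "pcompose (chromatic_poly V E) [:1, 1:] =
      (\<Sum>T\<in>independent_sets V E. chromatic_poly (V - T) (induced_edges E (V - T)))"
  proof (rule poly_eq_if_eq_on_positive_nats)
    fix k :: nat assume "k \<ge> 1"
    then show "poly (pcompose (chromatic_poly V E) [:1, 1:]) (of_nat k) =
        poly (\<Sum>T\<in>independent_sets V E. chromatic_poly (V - T) (induced_edges E (V - T))) (of_nat k)"
      using poly_chromatic_poly[of "Suc k"] fin_graph.poly_chromatic_poly[OF fin_graph_induced]
      by (simp add: poly_pcompose poly_sum card_proper_colourings_Suc)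
  qed
  from arg_cong[OF this, of "\<lambda>p. poly p x"] show ?thesis
    by (simp add: poly_pcompose poly_sum add.commute)
qed

text \<open>The chromatic polynomial is characterised by its values at positive integers only; the
  polynomial counting colourings with any number of colours, zero included, coincides with it.\<close>

lemma (in fin_graph) poly_chromatic_poly_0:
  "poly (chromatic_poly V E) 0 = (if V = {} then 1 else 0)"
proof -
  have sub: "{(x, y). {x, y} \<in> E} \<subseteq> V \<times> V"
    using edge_endpoints by auto
  then obtain es where es: "set es = {(x, y). {x, y} \<in> E}"
    using finite_list finite_subset finite_vertices by (metis finite_SigmaI)
  obtain p :: "rat poly" where
    p: "\<And>k. poly p (of_nat k) = of_nat (card (proper_colourings V E k))"
    using colouring_count_poly[of V es] finite_vertices sub
    unfolding es proper_colourings_def by auto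
  have "chromatic_poly V E = p"
    by (rule poly_eq_if_eq_on_positive_nats) (simp add: p poly_chromatic_poly)
  moreover have "proper_colourings V E 0 = (if V = {} then {\<lambda>_. undefined} else {})"
    using edge_endpoints by (auto simp: proper_colourings_def PiE_eq_empty_iff)
  ultimately show ?thesis
    using p[of 0] by simp
qed

section \<open>Compatible pairs and sinks of the top colour\<close>

definition compatible_pairs :: "'a set \<Rightarrow> 'a set set \<Rightarrow> nat \<Rightarrow> (('a \<Rightarrow> nat) \<times> ('a \<times> 'a) set) set"
  where "compatible_pairs V E k =
    {(f, D). f \<in> V \<rightarrow>\<^sub>E {1..k} \<and> acyclic_orientation E D \<and> (\<forall>x y. (x, y) \<in> D \<longrightarrow> f x \<le> f y)}"

lemma (in fin_graph) orientation_subset: "D \<subseteq> V \<times> V" if "orientation E D"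
  using that edge_endpoints unfolding orientation_def by fast

lemma (in fin_graph) finite_compatible_pairs: "finite (compatible_pairs V E k)"
proof (rule finite_subset)
  show "compatible_pairs V E k \<subseteq> (V \<rightarrow>\<^sub>E {1..k}) \<times> Pow (V \<times> V)"
    using orientation_subset by (auto simp: compatible_pairs_def acyclic_orientation_def)
  show "finite ((V \<rightarrow>\<^sub>E {1..k}) \<times> Pow (V \<times> V))"
    using finite_vertices by (simp add: finite_PiE)
qed

lemma alternating_sum_Pow:
  assumes "finite A"
  shows "(\<Sum>T\<in>Pow A. (- 1 :: 'b :: comm_ring_1) ^ card T) = (if A = {} then 1 else 0)"
proof -
  have "(\<Sum>T\<in>Pow A. (- 1 :: 'b) ^ card T) = (\<Prod>a\<in>A. - 1 + 1)"
    using assms by (subst prod_add) simp_all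
  then show ?thesis
    using assms by (simp add: power_0_left)
qed

text \<open>No path can continue after entering \<open>T\<close>, so a cycle would have to lie within \<open>D\<close>.\<close>

lemma acyclic_insert_sinks:
  assumes "acyclic D" and "\<And>x y. (x, y) \<in> D \<Longrightarrow> x \<notin> T"
    and "\<And>x y. (x, y) \<in> R \<Longrightarrow> x \<notin> T \<and> y \<in> T"
  shows "acyclic (D \<union> R)"
proof -
  have sink: "x \<notin> T" if "(x, y) \<in> (D \<union> R)\<^sup>+" for x y
    using that assms(2,3) by (induction rule: trancl_induct) auto
  have "(x, y) \<in> D\<^sup>+ \<or> y \<in> T" if "(x, y) \<in> (D \<union> R)\<^sup>+" for x y
    using that
  proof (induction rule: trancl_induct)
    case (base y)
    then show ?case using assms(3) by auto
  next
    case (step y z)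
    then have "y \<notin> T" using assms(2,3) by auto
    with step show ?case using assms(3) by (auto intro: trancl_into_trancl)
  qed
  then show ?thesis
    using sink assms(1) by (meson acyclic_def)
qed

definition top_sinks :: "'a set \<Rightarrow> nat \<Rightarrow> ('a \<Rightarrow> nat) \<times> ('a \<times> 'a) set \<Rightarrow> 'a set" where
  "top_sinks V k = (\<lambda>(f, D). {v \<in> V. f v = k \<and> (\<forall>y. (v, y) \<notin> D)})"

text \<open>An edge within \<open>T\<close> would be directed away from one of its ends, which could not be a sink.\<close>

lemma (in fin_graph) independent_if_subset_top_sinks:
  assumes "(f, D) \<in> compatible_pairs V E k" "T \<subseteq> top_sinks V k (f, D)"
  shows "T \<in> independent_sets V E"
  using assms
  unfolding compatible_pairs_def top_sinks_def independent_sets_def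
    acyclic_orientation_def orientation_def by blast

text \<open>The requirement that all vertices of \<open>T\<close> are sinks of the top colour fixes their colour and
  the direction of every edge that meets \<open>T\<close>. It imposes nothing on the rest: such an edge never
  violates compatibility, because its head has the largest colour, and never lies on a cycle.\<close>

lemma (in fin_graph) card_compatible_pairs_sinks:
  assumes T: "T \<in> independent_sets V E"
  shows "card {p \<in> compatible_pairs V E (Suc k). T \<subseteq> top_sinks V (Suc k) p} =
    card (compatible_pairs (V - T) (induced_edges E (V - T)) (Suc k))"
proof (rule bij_betw_same_card, rule bij_betwI)
  let ?A = "{p \<in> compatible_pairs V E (Suc k). T \<subseteq> top_sinks V (Suc k) p}"
  let ?E = "induced_edges E (V - T)"
  let ?B = "compatible_pairs (V - T) ?E (Suc k)"
  let ?R = "{(x, y). {x, y} \<in> E \<and> y \<in> T}"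
  let ?ext = "\<lambda>g v. if v \<in> T then Suc k else g v"
  let ?\<phi> = "\<lambda>(f, D). (restrict f (V - T), D \<inter> (V - T) \<times> (V - T))"
  let ?\<psi> = "\<lambda>(g, D). (?ext g, D \<union> ?R)"
  have TV: "T \<subseteq> V" and indep: "\<And>x y. x \<in> T \<Longrightarrow> y \<in> T \<Longrightarrow> {x, y} \<notin> E"
    using T by (auto simp: independent_sets_def)
  have edgeI: "{x, y} \<in> ?E \<longleftrightarrow> {x, y} \<in> E \<and> x \<notin> T \<and> y \<notin> T" for x y
    using edge_endpoints[of x y] by (auto simp: induced_edges_def)
  show "?\<phi> \<in> ?A \<rightarrow> ?B"
  proof (safe)
    fix f D assume fD: "(f, D) \<in> compatible_pairs V E (Suc k)" "T \<subseteq> top_sinks V (Suc k) (f, D)"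
    then have D: "orientation E D" "acyclic D"
      by (auto simp: compatible_pairs_def acyclic_orientation_def)
    have "orientation ?E (D \<inter> (V - T) \<times> (V - T))"
      using D(1) orientation_subset[OF D(1)] unfolding orientation_def edgeI
      by (auto dest: edge_endpoints)
    moreover have "acyclic (D \<inter> (V - T) \<times> (V - T))"
      using D(2) by (rule acyclic_subset) auto
    ultimately show "(restrict f (V - T), D \<inter> (V - T) \<times> (V - T)) \<in> ?B"
      using fD(1) by (auto simp: compatible_pairs_def acyclic_orientation_def)
  qed
  show "?\<psi> \<in> ?B \<rightarrow> ?A"
  proof (safe)
    fix g D assume gD: "(g, D) \<in> ?B"
    then have g: "g \<in> (V - T) \<rightarrow>\<^sub>E {1..Suc k}" and D: "orientation ?E D" "acyclic D"
      and le: "\<And>x y. (x, y) \<in> D \<Longrightarrow> g x \<le> g y"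
      by (auto simp: compatible_pairs_def acyclic_orientation_def)
    have D': "{x, y} \<in> E \<and> x \<notin> T \<and> y \<notin> T" if "(x, y) \<in> D" for x y
      using D(1) that unfolding orientation_def edgeI by blast
    have gk: "g v \<in> {1..Suc k}" if "v \<in> V" "v \<notin> T" for v
      using PiE_mem[OF g, of v] that by simp
    have "?ext g \<in> V \<rightarrow>\<^sub>E {1..Suc k}"
      using gk TV g by (fastforce simp: PiE_iff extensional_def)
    moreover have "orientation E (D \<union> ?R)"
      unfolding orientation_def
    proof (intro conjI allI impI)
      show "{x, y} \<in> E" if "(x, y) \<in> D \<union> ?R" for x y
        using that D' by auto
      show "((x, y) \<in> D \<union> ?R) \<noteq> ((y, x) \<in> D \<union> ?R)" if e: "{x, y} \<in> E" for x y
      proof (cases "x \<in> T \<or> y \<in> T")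
        case True
        then show ?thesis using e indep[of x y] D'[of x y] D'[of y x]
          by (auto simp: insert_commute)
      next
        case False
        then show ?thesis using e D(1) edgeI[of x y] unfolding orientation_def by auto
      qed
    qed
    moreover have "acyclic (D \<union> ?R)"
      using D(2) D' indep by (intro acyclic_insert_sinks[where T = T]) auto
    moreover have "?ext g x \<le> ?ext g y" if "(x, y) \<in> D \<union> ?R" for x y
    proof (cases "y \<in> T")
      case True
      have "x \<in> V" using that D'[of x y] edge_endpoints(1)[of x y] by auto
      then show ?thesis using True gk[of x] by auto
    next
      case False
      then show ?thesis using that D'[of x y] le by auto
    qed
    ultimately show "(?ext g, D \<union> ?R) \<in> compatible_pairs V E (Suc k)"
      by (simp add: compatible_pairs_def acyclic_orientation_def)
    show "v \<in> top_sinks V (Suc k) (?ext g, D \<union> ?R)" if "v \<in> T" for v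
      using that TV D' indep by (auto simp: top_sinks_def)
  qed
  show "?\<psi> (?\<phi> p) = p" if p: "p \<in> ?A" for p
  proof -
    obtain f D where [simp]: "p = (f, D)" by fastforce
    have f: "f \<in> V \<rightarrow>\<^sub>E {1..Suc k}" and D: "orientation E D"
      and sink: "\<And>v. v \<in> T \<Longrightarrow> f v = Suc k" "\<And>v y. v \<in> T \<Longrightarrow> (v, y) \<notin> D"
      using p by (auto simp: compatible_pairs_def acyclic_orientation_def top_sinks_def)
    have "?ext (restrict f (V - T)) = f"
      using f sink(1) by (auto simp: PiE_iff extensional_def fun_eq_iff)
    moreover have "D \<inter> (V - T) \<times> (V - T) \<union> ?R = D"
    proof -
      have "(x, y) \<in> D" if "{x, y} \<in> E" "y \<in> T" for x y
        using that D sink(2)[of y x] unfolding orientation_def by blast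
      then show ?thesis
        using D orientation_subset[OF D] sink(2) unfolding orientation_def by blast
    qed
    ultimately show ?thesis by simp
  qed
  show "?\<phi> (?\<psi> p) = p" if p: "p \<in> ?B" for p
  proof -
    obtain g D where [simp]: "p = (g, D)" by fastforce
    have g: "g \<in> (V - T) \<rightarrow>\<^sub>E {1..Suc k}" and D: "orientation ?E D"
      using p by (auto simp: compatible_pairs_def acyclic_orientation_def)
    have "D \<subseteq> (V - T) \<times> (V - T)"
      using fin_graph.orientation_subset[OF fin_graph_induced D] by blast
    moreover have "restrict (?ext g) (V - T) = g"
      using g by (auto simp: PiE_iff extensional_def fun_eq_iff)
    ultimately show ?thesis by auto
  qed
qed

text \<open>Successors of a vertex of the top colour have the top colour too, so following directed edges
  from such a vertex ends, by acyclicity, in a sink of the top colour.\<close>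

lemma (in fin_graph) top_sinks_eq_empty_iff:
  assumes "(f, D) \<in> compatible_pairs V E (Suc k)"
  shows "top_sinks V (Suc k) (f, D) = {} \<longleftrightarrow> (f, D) \<in> compatible_pairs V E k"
proof
  have f: "f \<in> V \<rightarrow>\<^sub>E {1..Suc k}" and D: "orientation E D" "acyclic D"
    and le: "\<And>x y. (x, y) \<in> D \<Longrightarrow> f x \<le> f y"
    using assms by (auto simp: compatible_pairs_def acyclic_orientation_def)
  assume empty: "top_sinks V (Suc k) (f, D) = {}"
  have False if v: "v \<in> V" "f v = Suc k" for v
  proof -
    have "finite D"
      using orientation_subset[OF D(1)] finite_vertices by (meson finite_SigmaI finite_subset)
    then have "wf (D\<inverse>)"
      using D(2) by (rule finite_acyclic_wf_converse)
    moreover have "v \<in> {v \<in> V. f v = Suc k}" using v by simp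
    \<comment> \<open>A minimal element for the converse of \<open>D\<close> has no successor of the top colour.\<close>
    ultimately obtain z where z: "z \<in> V" "f z = Suc k"
        and min: "\<And>y. (y, z) \<in> D\<inverse> \<Longrightarrow> y \<notin> {v \<in> V. f v = Suc k}"
      by (rule wfE_min) auto
    have "(z, y) \<notin> D" for y
    proof
      assume zy: "(z, y) \<in> D"
      then have "y \<in> V" using orientation_subset[OF D(1)] by auto
      moreover have "f y = Suc k"
        using le[OF zy] z(2) PiE_mem[OF f \<open>y \<in> V\<close>] by simp
      ultimately show False using min zy by auto
    qed
    then show False using empty z by (auto simp: top_sinks_def)
  qed
  then have "f \<in> V \<rightarrow>\<^sub>E {1..k}"
    using f by (fastforce simp: PiE_iff le_Suc_eq)
  then show "(f, D) \<in> compatible_pairs V E k"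
    using assms by (simp add: compatible_pairs_def)
next
  assume "(f, D) \<in> compatible_pairs V E k"
  then show "top_sinks V (Suc k) (f, D) = {}"
    by (fastforce simp: compatible_pairs_def top_sinks_def PiE_iff)
qed

text \<open>Exchanging the two summations turns the right-hand side into a sum over compatible pairs on
  \<open>V\<close>, each weighted by the alternating sum over the subsets of its set of top-coloured sinks.\<close>

lemma (in fin_graph) card_compatible_pairs_shift:
  "(of_nat (card (compatible_pairs V E k)) :: rat) =
     (\<Sum>T\<in>independent_sets V E. (- 1) ^ card T *
        of_nat (card (compatible_pairs (V - T) (induced_edges E (V - T)) (Suc k))))"
proof -
  let ?W = "compatible_pairs V E (Suc k)"
  let ?S = "top_sinks V (Suc k)"
  have fin: "finite ?W" "finite (independent_sets V E)"
    by (rule finite_compatible_pairs finite_independent_sets)+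
  have sub: "compatible_pairs V E k \<subseteq> ?W"
    by (fastforce simp: compatible_pairs_def PiE_iff)
  have "(\<Sum>T\<in>independent_sets V E. (- 1) ^ card T *
        of_nat (card (compatible_pairs (V - T) (induced_edges E (V - T)) (Suc k)))) =
      (\<Sum>T\<in>independent_sets V E. \<Sum>p | p \<in> ?W \<and> T \<subseteq> ?S p. (- 1 :: rat) ^ card T)"
    by (simp add: card_compatible_pairs_sinks[symmetric] mult.commute)
  also have "\<dots> = (\<Sum>p\<in>?W. \<Sum>T | T \<in> independent_sets V E \<and> T \<subseteq> ?S p. (- 1) ^ card T)"
    by (rule sum.swap_restrict[OF fin(2) fin(1)])
  also have "\<dots> = (\<Sum>p\<in>?W. \<Sum>T\<in>Pow (?S p). (- 1) ^ card T)"
    using independent_if_subset_top_sinks by (intro sum.cong) auto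
  also have "\<dots> = (\<Sum>p\<in>?W. if ?S p = {} then 1 else 0)"
    by (intro sum.cong refl alternating_sum_Pow)
      (auto simp: top_sinks_def finite_vertices)
  also have "\<dots> = (\<Sum>p\<in>?W. if p \<in> compatible_pairs V E k then 1 else 0)"
    using top_sinks_eq_empty_iff by (intro sum.cong) auto
  also have "\<dots> = of_nat (card (compatible_pairs V E k))"
    using fin(1) sub by (simp add: sum.If_cases Int_absorb1)
  finally show ?thesis ..
qed

section \<open>Reciprocity\<close>

lemma (in fin_graph) card_compatible_pairs_0:
  "card (compatible_pairs V E 0) = (if V = {} then 1 else 0)"
proof (cases "V = {}")
  case True
  then have "E = {}"
    using edges_two_subsets by fastforce
  with True have "compatible_pairs V E 0 = {(\<lambda>_. undefined, {})}"
    by (auto simp: compatible_pairs_def acyclic_orientation_def orientation_def acyclic_def)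
  with True show ?thesis by simp
next
  case False
  then have "compatible_pairs V E 0 = {}"
    by (auto simp: compatible_pairs_def)
  with False show ?thesis by simp
qed

text \<open>The case \<open>k = 0\<close> is included because it is the base of the induction on \<open>k\<close>.\<close>

lemma stanley_reciprocity:
  assumes "fin_graph V E"
  shows "(- 1) ^ card V * poly (chromatic_poly V E) (- of_nat k) =
    of_nat (card (compatible_pairs V E k))"
  using assms
proof (induction "card V" arbitrary: V E k rule: less_induct)
  case less
  interpret fin_graph V E by fact
  define q where "q S j = (- 1) ^ card S *
    poly (chromatic_poly S (induced_edges E S)) (- of_nat j)" for S and j :: nat
  define N :: "'a set \<Rightarrow> nat \<Rightarrow> rat" where
    "N S j = of_nat (card (compatible_pairs S (induced_edges E S) j))" for S j
  let ?I = "independent_sets V E"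
  have q_shift: "q V j = (\<Sum>T\<in>?I. (- 1) ^ card T * q (V - T) (Suc j))" for j
  proof -
    have "card V = card T + card (V - T)" if "T \<in> ?I" for T
      using that finite_vertices
      by (metis (no_types, lifting) card_Diff_subset card_mono finite_subset
          independent_sets_def le_add_diff_inverse mem_Collect_eq)
    then have "(- 1) ^ card T * q (V - T) (Suc j) = (- 1) ^ card V *
        poly (chromatic_poly (V - T) (induced_edges E (V - T))) (- of_nat (Suc j))"
      if "T \<in> ?I" for T
      using that by (simp add: q_def power_add mult.assoc)
    then have "(\<Sum>T\<in>?I. (- 1) ^ card T * q (V - T) (Suc j)) =
        (\<Sum>T\<in>?I. (- 1) ^ card V *
          poly (chromatic_poly (V - T) (induced_edges E (V - T))) (- of_nat (Suc j)))"
      by (intro sum.cong refl)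
    then show ?thesis
      using chromatic_poly_shift[of "- of_nat (Suc j)"]
      by (simp add: q_def induced_edges_all flip: sum_distrib_left)
  qed
  have N_shift: "N V j = (\<Sum>T\<in>?I. (- 1) ^ card T * N (V - T) (Suc j))" for j
    using card_compatible_pairs_shift by (simp add: N_def induced_edges_all)
  have smaller: "q (V - T) j = N (V - T) j" if "T \<in> ?I - {{}}" for T j
  proof -
    have "card (V - T) < card V"
      using that finite_vertices
      by (intro psubset_card_mono) (auto simp: independent_sets_def)
    then show ?thesis
      unfolding q_def N_def by (intro less.hyps fin_graph_induced) auto
  qed
  \<comment> \<open>Only the term for \<open>T = {}\<close> involves \<open>V\<close> itself, so each recurrence determines the value
    at \<open>j + 1\<close> from the value at \<open>j\<close> and the values on smaller vertex sets.\<close>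
  have split: "(\<Sum>T\<in>?I. (- 1) ^ card T * h (V - T)) =
      h V + (\<Sum>T\<in>?I - {{}}. (- 1) ^ card T * h (V - T))" for h :: "'a set \<Rightarrow> rat"
    by (subst sum.remove[OF finite_independent_sets empty_in_independent_sets]) simp
  have "q V k = N V k"
  proof (induction k)
    case 0
    show ?case
      by (simp add: q_def N_def induced_edges_all poly_chromatic_poly_0 card_compatible_pairs_0)
  next
    case (Suc j)
    have "q V (Suc j) + (\<Sum>T\<in>?I - {{}}. (- 1) ^ card T * q (V - T) (Suc j)) =
        N V (Suc j) + (\<Sum>T\<in>?I - {{}}. (- 1) ^ card T * N (V - T) (Suc j))"
      using Suc.IH unfolding q_shift[of j] N_shift[of j]
        split[of "\<lambda>S. q S (Suc j)"] split[of "\<lambda>S. N S (Suc j)"] .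
    then show ?case
      by (simp add: smaller)
  qed
  then show ?case
    by (simp add: q_def N_def induced_edges_all)
qed

theorem corollary2p17:
  fixes V :: "'a set" and E :: "'a set set" and k :: nat
  assumes "fin_graph V E" and "k \<ge> 1"
  shows "(- 1) ^ card V * poly (chromatic_poly V E) (- of_nat k) =
    of_nat (card {(f, D). f \<in> V \<rightarrow>\<^sub>E {1..k} \<and> acyclic_orientation E D \<and>
                          (\<forall>x y. (x, y) \<in> D \<longrightarrow> f x \<le> f y)})"
  using stanley_reciprocity[OF assms(1)] unfolding compatible_pairs_def .

end
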